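(* Let $\mathcal F\subseteq\omega^\omega$ and let $\mathcal I,\mathcal J$ be ideals on $\omega$ such that $\mathcal I$ is tall and $\mathcal I\not\le_{\mathcal F}\mathcal J\restriction A$ for all $A\notin\mathcal J$. Then: (1) $\mathfrak p(\mathcal J)\le\mathfrak{fip}(\mathcal I,\mathcal J,\mathcal F)$; (2) $\operatorname{add}^*(\mathcal I)\le\mathfrak{fip}(\mathcal I,\mathcal J,\mathcal F)$.
   Context: An ideal on a set $X$ is a family of subsets of $X$ closed under finite unions and subsets, containing all finite subsets of $X$ and not containing $X$; $\mathcal J^+$ is the family of subsets of $X$ not in $\mathcal J$. $\mathcal I$ on $\omega$ is tall if every infinite $A\subseteq\omega$ contains an infinite $B\in\mathcal I$. For $A\notin\mathcal J$, $\mathcal J\restriction A=\{B\cap A:B\in\mathcal J\}$ (an ideal on $A$), and $\mathcal I\le_{\mathcal F}\mathcal J\restriction A$ means that there is $f\in\mathcal F$ with $f^{-1}[B]\cap A\in\mathcal J$ for every $B\in\mathcal I$ (functions in $\mathcal F$ are restricted to $A$). A nonempty family $\mathcal A\subseteq\mathcal P(\omega)$ has $\mathcal J^+$-FIP if $\bigcap F\in\mathcal J^+$ for each finite $F\subseteq\mathcal A$. A set $B\in\mathcal J^+$ is a $\mathcal J^+$-pseudointersection of $\mathcal A$ if $B\setminus A\in\mathcal J$ for each $A\in\mathcal A$. With $\mathfrak c=2^{\aleph_0}$: $\mathfrak p(\mathcal J)=\min(\{|\mathcal A|:\mathcal A$ has $\mathcal J^+$-FIP but has no $\mathcal J^+$-pseudointersection$\}\cup\{\mathfrak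 c^+\})$; $\operatorname{add}^*(\mathcal I)=\min\{|\mathcal A|:\mathcal A\subseteq\mathcal I$ and there is no $B\in\mathcal I$ with $A\setminus B$ finite for all $A\in\mathcal A\}$ (well defined for tall $\mathcal I$); $\mathfrak{fip}(\mathcal I,\mathcal J,\mathcal F)$ is the minimum of the set consisting of $\mathfrak c^+$ and all cardinals $|\mathcal A|$ such that $\mathcal A\subseteq\mathcal P(\omega)$ has $\mathcal J^+$-FIP and it is not true that for every $f\in\mathcal F$ there is $B\in\mathcal I$ such that $\mathcal A\cup\{f^{-1}[B]\}$ has $\mathcal J^+$-FIP. *)

theory Defs
  imports Main
begin

unbundle cardinal_syntax

definition ideal_on :: "'a set \<Rightarrow> 'a set set \<Rightarrow> bool" where
  "ideal_on X J \<longleftrightarrow>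
     J \<subseteq> Pow X \<and>
     (\<forall>\<A>. finite \<A> \<and> \<A> \<subseteq> J \<longrightarrow> \<Union>\<A> \<in> J) \<and>
     (\<forall>A B. A \<in> J \<and> B \<subseteq> A \<longrightarrow> B \<in> J) \<and>
     (\<forall>A. A \<subseteq> X \<and> finite A \<longrightarrow> A \<in> J) \<and>
     X \<notin> J"

definition tall :: "nat set set \<Rightarrow> bool" where
  "tall I \<longleftrightarrow> (\<forall>A. infinite A \<longrightarrow> (\<exists>B. B \<subseteq> A \<and> infinite B \<and> B \<in> I))"

text \<open>\<open>le_restr F I J A\<close> is the relation $\mathcal I\le_{\mathcal F}\mathcal J\restriction A$.\<close>

definition le_restr ::
    "(nat \<Rightarrow> nat) set \<Rightarrow> nat set set \<Rightarrow> nat set set \<Rightarrow> nat set \<Rightarrow> bool" where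
  "le_restr F I J A \<longleftrightarrow> (\<exists>f\<in>F. \<forall>B\<in>I. f -` B \<inter> A \<in> J)"

text \<open>For \<open>\<B> = {}\<close> the intersection is all of \<open>\<omega>\<close>, which is positive for every ideal.\<close>

definition has_FIP :: "nat set set \<Rightarrow> nat set set \<Rightarrow> bool" where
  "has_FIP J \<A> \<longleftrightarrow> \<A> \<noteq> {} \<and> (\<forall>\<B>. finite \<B> \<and> \<B> \<subseteq> \<A> \<longrightarrow> \<Inter>\<B> \<notin> J)"

definition pseudointersection :: "nat set set \<Rightarrow> nat set set \<Rightarrow> nat set \<Rightarrow> bool" where
  "pseudointersection J \<A> B \<longleftrightarrow> B \<notin> J \<and> (\<forall>A\<in>\<A>. B - A \<in> J)"

text \<open>
  Cardinals are represented by cardinal orders, and are compared by \<open>\<le>o\<close>. The sizes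
  of families of subsets of \<open>\<omega>\<close> and the cardinal $\mathfrak c^+$ need a common
  type to be members of one set. So a family is measured by its image under the
  injection \<open>x \<mapsto> {x}\<close>, which puts its cardinal on the type of \<open>cardSuc |UNIV :: nat set set|\<close>.
\<close>

definition fam_card :: "nat set set \<Rightarrow> nat set set rel" where
  "fam_card \<A> = |(\<lambda>A. {A}) ` \<A>|"

definition cont_succ :: "nat set set rel" where
  "cont_succ = cardSuc |UNIV :: nat set set|"

text \<open>The least element of a nonempty set of cardinals, determined up to \<open>=o\<close>.\<close>

definition card_min :: "'a rel set \<Rightarrow> 'a rel" where
  "card_min R = (SOME r. r \<in> R \<and> (\<forall>r'\<in>R. r \<le>o r'))"

lemma card_min:
  assumes "R \<noteq> {}" and "\<And>r. r \<in> R \<Longrightarrow> Card_order r"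
  shows "card_min R \<in> R" and "\<And>r. r \<in> R \<Longrightarrow> card_min R \<le>o r"
proof -
  have "\<exists>r. r \<in> R \<and> (\<forall>r'\<in>R. r \<le>o r')"
    using exists_minim_Card_order[of R] assms by blast
  from someI_ex[OF this] show "card_min R \<in> R" and "\<And>r. r \<in> R \<Longrightarrow> card_min R \<le>o r"
    unfolding card_min_def by blast+
qed

lemma fam_card_ordIso: "fam_card \<A> =o |\<A>|"
  unfolding fam_card_def
  by (rule ordIso_symmetric, rule card_of_ordIsoI[of "\<lambda>A. {A}"])
     (simp add: bij_betw_def inj_on_def)

definition p_num :: "nat set set \<Rightarrow> nat set set rel" where
  "p_num J = card_min
     ({fam_card \<A> | \<A>. has_FIP J \<A> \<and> \<not> (\<exists>B. pseudointersection J \<A> B)} \<union> {cont_succ})"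

definition add_star :: "nat set set \<Rightarrow> nat set set rel" where
  "add_star I = card_min
     {fam_card \<A> | \<A>. \<A> \<subseteq> I \<and> \<not> (\<exists>B\<in>I. \<forall>A\<in>\<A>. finite (A - B))}"

definition fip_num ::
    "nat set set \<Rightarrow> nat set set \<Rightarrow> (nat \<Rightarrow> nat) set \<Rightarrow> nat set set rel" where
  "fip_num I J F = card_min
     ({fam_card \<A> | \<A>. has_FIP J \<A> \<and>
         \<not> (\<forall>f\<in>F. \<exists>B\<in>I. has_FIP J (\<A> \<union> {f -` B}))} \<union> {cont_succ})"

text \<open>The set defining \<open>add_star\<close> is nonempty for tall ideals, as \<open>I\<close> itself is a witness.\<close>

lemma add_star_witness:
  assumes "ideal_on UNIV I" and "tall I"
  shows "\<not> (\<exists>B\<in>I. \<forall>A\<in>I. finite (A - B))"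
proof
  assume "\<exists>B\<in>I. \<forall>A\<in>I. finite (A - B)"
  then obtain B where B: "B \<in> I" "\<forall>A\<in>I. finite (A - B)" by blast
  have fin: "finite C \<Longrightarrow> C \<in> I" for C
    using assms(1) by (simp add: ideal_on_def)
  have un: "finite \<A> \<Longrightarrow> \<A> \<subseteq> I \<Longrightarrow> \<Union>\<A> \<in> I" for \<A>
    using assms(1) by (simp add: ideal_on_def)
  have "infinite (- B)"
  proof
    assume "finite (- B)"
    then have "\<Union>{B, - B} \<in> I" using fin B(1) by (intro un) auto
    then show False using assms(1) by (simp add: ideal_on_def)
  qed
  then obtain C where C: "C \<subseteq> - B" "infinite C" "C \<in> I"
    using assms(2) unfolding tall_def by blast
  then have "C - B = C" by blast
  with C B(2) show False by metis
qed

end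

theory Submission
  imports Defs
begin

text \<open>
  Let \<open>\<A>\<close> be a family with the \<open>J\<close>-positive FIP, and let \<open>f \<in> F\<close>. Suppose that no \<open>B \<in> I\<close> keeps
  the FIP when \<open>f -` B\<close> is added to \<open>\<A>\<close>. Both bounds hold because such an \<open>\<A>\<close> yields, without
  growing in cardinality, a witness for \<open>p_num J\<close> and one for \<open>add_star I\<close>. The hypothesis
  supplies, for each single positive set \<open>D\<close>, some \<open>B \<in> I\<close> with \<open>f -` B \<inter> D\<close> positive; the task is
  to find one \<open>B\<close> that serves all finite intersections \<open>D\<close> of members of \<open>\<A>\<close> at once.

  For \<open>p_num\<close>: a pseudointersection \<open>P\<close> of \<open>\<A>\<close> is itself a positive set, so some \<open>B\<close> serves \<open>P\<close>.
  As \<open>P\<close> is contained in every finite intersection modulo \<open>J\<close>, the same \<open>B\<close> serves all of them.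
  Hence \<open>\<A>\<close> has no pseudointersection (lemma \<open>FIP_extension_by_pseudointersection\<close>).

  For \<open>add_star\<close>: if \<open>\<A>\<close> is finite, it suffices to serve \<open>\<Inter>\<A>\<close>, so \<open>\<A>\<close> must be infinite and has
  at most \<open>|\<A>|\<close> finite intersections. One would like to choose a set \<open>b D \<in> I\<close> serving each
  finite intersection \<open>D\<close>, and to take a \<open>C \<in> I\<close> that almost contains every \<open>b D\<close>. The obstacle is
  that \<open>f\<close> need not be finite-to-one modulo \<open>J\<close>: discarding the finite set \<open>b D - C\<close> may discard a
  positive part of \<open>D\<close>. Lemma \<open>directed_family_common_preimage\<close> therefore looks at the set of those
  \<open>n\<close> whose fibre is positive on \<open>D\<close>. If it is always infinite, tallness gives \<open>b D\<close> inside
  it, and a single point of \<open>b D \<inter> C\<close> is enough. If it is never empty but finite for some \<open>D\<close>, the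
  sets decrease with \<open>D\<close> and so have a common point \<open>n\<close>, and \<open>{n}\<close> serves all \<open>D\<close>. If it is empty for some \<open>D\<close>,
  then below \<open>D\<close> preimages of finite sets are negligible and the naive argument works.

  If no such \<open>\<A>\<close> exists, then \<open>fip_num I J F\<close> is the successor of the continuum, which bounds the
  size of every family of subsets of \<open>\<omega>\<close>.
\<close>

section \<open>Ideals and finite intersections\<close>

lemma ideal_on_subset: "ideal_on X J \<Longrightarrow> A \<in> J \<Longrightarrow> B \<subseteq> A \<Longrightarrow> B \<in> J"
  unfolding ideal_on_def by blast

lemma ideal_on_Union: "ideal_on X J \<Longrightarrow> finite \<A> \<Longrightarrow> \<A> \<subseteq> J \<Longrightarrow> \<Union>\<A> \<in> J"
  unfolding ideal_on_def by blast

lemma ideal_on_Un: "ideal_on X J \<Longrightarrow> A \<in> J \<Longrightarrow> B \<in> J \<Longrightarrow> A \<union> B \<in> J"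
  using ideal_on_Union[of X J "{A, B}"] by simp

lemma ideal_on_finite: "ideal_on X J \<Longrightarrow> A \<subseteq> X \<Longrightarrow> finite A \<Longrightarrow> A \<in> J"
  unfolding ideal_on_def by blast

lemma has_FIP_iff_Fpow: "has_FIP J \<A> \<longleftrightarrow> \<A> \<noteq> {} \<and> (\<forall>\<B>\<in>Fpow \<A>. \<Inter>\<B> \<notin> J)"
  unfolding has_FIP_def Fpow_def by blast

lemma has_FIP_Un_singleton:
  assumes J: "ideal_on UNIV J" and meet: "\<And>\<B>. \<B> \<in> Fpow \<A> \<Longrightarrow> X \<inter> \<Inter>\<B> \<notin> J"
  shows "has_FIP J (\<A> \<union> {X})"
  unfolding has_FIP_def
proof (intro conjI allI impI)
  show "\<A> \<union> {X} \<noteq> {}" by simp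
next
  fix \<B> assume \<B>: "finite \<B> \<and> \<B> \<subseteq> \<A> \<union> {X}"
  then have "\<B> - {X} \<in> Fpow \<A>" by (auto simp: Fpow_def)
  from meet[OF this] have "X \<inter> \<Inter>(\<B> - {X}) \<notin> J" .
  moreover have "X \<inter> \<Inter>(\<B> - {X}) \<subseteq> \<Inter>\<B>" by blast
  ultimately show "\<Inter>\<B> \<notin> J" using ideal_on_subset[OF J] by blast
qed

text \<open>The layers of sets with at most \<open>n\<close> elements do not outgrow \<open>A\<close>, because \<open>A \<times> A\<close> does not.\<close>

lemma card_of_Fpow_ordLeq_infinite:
  assumes "infinite A"
  shows "|Fpow A| \<le>o |A|"
proof -
  define S where "S n = {X. X \<subseteq> A \<and> finite X \<and> card X \<le> n}" for n :: nat
  have layer: "|S n| \<le>o |A|" for n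
  proof (induction n)
    case 0
    have "S 0 = {{}}" by (auto simp: S_def)
    moreover have "A \<noteq> {}" using assms by auto
    ultimately show ?case by (simp add: card_of_singl_ordLeq)
  next
    case (Suc n)
    have ne: "{} \<in> S n" by (simp add: S_def)
    let ?g = "\<lambda>(x, X). insert x X"
    have cover: "S (Suc n) \<subseteq> insert {} (?g ` (A \<times> S n))"
    proof
      fix X assume X: "X \<in> S (Suc n)"
      show "X \<in> insert {} (?g ` (A \<times> S n))"
      proof (cases "X = {}")
        case False
        then obtain x where x: "x \<in> X" by blast
        then have "(x, X - {x}) \<in> A \<times> S n" using X by (auto simp: S_def)
        moreover have "X = ?g (x, X - {x})" using x by auto
        ultimately show ?thesis by blast
      qed simp
    qed
    have "|?g ` (A \<times> S n)| \<le>o |A|"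
    proof -
      have "|A \<times> S n| =o |A|"
        using assms ne Suc.IH by (intro card_of_Times_infinite_simps(1)) auto
      then show ?thesis
        using card_of_image ordLeq_ordIso_trans by blast
    qed
    moreover have "|{{}} :: 'a set set| \<le>o |A|"
      using assms by (intro card_of_singl_ordLeq) auto
    ultimately have "|{{}} \<union> ?g ` (A \<times> S n)| \<le>o |A|"
      using assms by (intro card_of_Un_ordLeq_infinite_Field)
        (simp_all only: Field_card_of card_of_card_order_on simp_thms)
    moreover have "|S (Suc n)| \<le>o |{{}} \<union> ?g ` (A \<times> S n)|"
      using cover by (intro card_of_mono1) simp
    ultimately show ?case by (metis ordLeq_transitive)
  qed
  have "Fpow A = (\<Union>n. S n)" by (auto simp: Fpow_def S_def)
  moreover have "|\<Union>n. S n| \<le>o |A|"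
    using assms infinite_iff_card_of_nat[of A] layer
    by (intro card_of_UNION_ordLeq_infinite) simp_all
  ultimately show ?thesis by simp
qed

section \<open>Extending a family by a preimage\<close>

lemma FIP_extension_by_pseudointersection:
  assumes J: "ideal_on UNIV J" and P: "pseudointersection J \<A> P" and X: "X \<inter> P \<notin> J"
  shows "has_FIP J (\<A> \<union> {X})"
proof (rule has_FIP_Un_singleton[OF J])
  fix \<B> assume "\<B> \<in> Fpow \<A>"
  then have "(\<Union>A\<in>\<B>. P - A) \<in> J"
    using P by (intro ideal_on_Union[OF J]) (auto simp: Fpow_def pseudointersection_def)
  moreover have "X \<inter> P \<subseteq> (X \<inter> \<Inter>\<B>) \<union> (\<Union>A\<in>\<B>. P - A)" by blast
  ultimately show "X \<inter> \<Inter>\<B> \<notin> J"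
    using X ideal_on_Un[OF J] ideal_on_subset[OF J] by metis
qed

text \<open>
  The sets \<open>b D\<close> are chosen before \<open>C\<close> is known, so that \<open>b ` \<D>\<close> can be tested against the
  definition of \<open>add_star\<close>. The set \<open>B\<close> that serves all of \<open>\<D>\<close> need not be \<open>C\<close>: if every member
  of \<open>\<D>\<close> has a positive fibre of \<open>f\<close>, but some member has only finitely many, \<open>B\<close> is a singleton.
\<close>

lemma directed_family_common_preimage:
  fixes f :: "nat \<Rightarrow> nat"
  assumes I: "ideal_on UNIV I" and J: "ideal_on UNIV J" and tall: "tall I"
    and directed: "\<And>D E. D \<in> \<D> \<Longrightarrow> E \<in> \<D> \<Longrightarrow> \<exists>G\<in>\<D>. G \<subseteq> D \<inter> E"
    and preim: "\<And>D. D \<in> \<D> \<Longrightarrow> \<exists>B\<in>I. f -` B \<inter> D \<notin> J"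
  shows "\<exists>b. b ` \<D> \<subseteq> I \<and>
    (\<forall>C\<in>I. (\<forall>D\<in>\<D>. finite (b D - C)) \<longrightarrow> (\<exists>B\<in>I. \<forall>D\<in>\<D>. f -` B \<inter> D \<notin> J))"
proof -
  define N where "N D = {n. f -` {n} \<inter> D \<notin> J}" for D
  have N_mono: "N G \<subseteq> N D" if "G \<subseteq> D" for G D
  proof -
    have "f -` {n} \<inter> G \<subseteq> f -` {n} \<inter> D" for n using that by blast
    then show ?thesis unfolding N_def using ideal_on_subset[OF J] by blast
  qed
  have "\<exists>B. B \<in> I \<and> f -` B \<inter> D \<notin> J \<and> (infinite (N D) \<longrightarrow> infinite B \<and> B \<subseteq> N D)"
    if D: "D \<in> \<D>" for D
  proof (cases "finite (N D)")
    case True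
    then show ?thesis using preim[OF D] by blast
  next
    case False
    then obtain B where B: "B \<subseteq> N D" "infinite B" "B \<in> I"
      using tall unfolding tall_def by blast
    then obtain n where n: "n \<in> B" using infinite_imp_nonempty by blast
    then have "f -` {n} \<inter> D \<notin> J" using B(1) unfolding N_def by blast
    moreover have "f -` {n} \<inter> D \<subseteq> f -` B \<inter> D" using n by blast
    ultimately have "f -` B \<inter> D \<notin> J" using ideal_on_subset[OF J] by blast
    with B show ?thesis by blast
  qed
  then obtain b where bI: "\<And>D. D \<in> \<D> \<Longrightarrow> b D \<in> I"
    and bpos: "\<And>D. D \<in> \<D> \<Longrightarrow> f -` b D \<inter> D \<notin> J"
    and binf: "\<And>D. D \<in> \<D> \<Longrightarrow> infinite (N D) \<Longrightarrow> infinite (b D) \<and> b D \<subseteq> N D"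
    by metis
  have "\<exists>B\<in>I. \<forall>D\<in>\<D>. f -` B \<inter> D \<notin> J"
    if C: "C \<in> I" and fin: "\<And>D. D \<in> \<D> \<Longrightarrow> finite (b D - C)" for C
  proof -
    consider (inf) "\<forall>D\<in>\<D>. infinite (N D)"
      | (empty) D where "D \<in> \<D>" "N D = {}"
      | (fin) D where "D \<in> \<D>" "finite (N D)" "\<forall>D\<in>\<D>. N D \<noteq> {}"
      by blast
    then show ?thesis
    proof cases
      case inf
      have "f -` C \<inter> D \<notin> J" if D: "D \<in> \<D>" for D
      proof -
        have b: "infinite (b D)" "b D \<subseteq> N D" using binf D inf by auto
        have "\<not> b D \<subseteq> b D - C" using b(1) fin[OF D] finite_subset by blast
        then obtain n where n: "n \<in> b D" "n \<in> C" by blast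
        then have "f -` {n} \<inter> D \<notin> J" using b(2) unfolding N_def by blast
        moreover have "f -` {n} \<inter> D \<subseteq> f -` C \<inter> D" using n by blast
        ultimately show ?thesis using ideal_on_subset[OF J] by blast
      qed
      with C show ?thesis by blast
    next
      case (empty D)
      have "f -` C \<inter> E \<notin> J" if E: "E \<in> \<D>" for E
      proof
        assume CE: "f -` C \<inter> E \<in> J"
        obtain G where G: "G \<in> \<D>" "G \<subseteq> D \<inter> E" using directed[OF empty(1) E] by blast
        then have "N G = {}" using N_mono[of G D] empty(2) by blast
        \<comment> \<open>All fibres are negligible on \<open>G\<close>, so the finite part of \<open>b G\<close> outside \<open>C\<close> may be dropped.\<close>
        then have "(\<Union>n\<in>b G - C. f -` {n} \<inter> G) \<in> J"
          using fin[OF G(1)] by (intro ideal_on_Union[OF J]) (auto simp: N_def)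
        moreover have "f -` b G \<inter> G \<subseteq> (\<Union>n\<in>b G - C. f -` {n} \<inter> G) \<union> (f -` C \<inter> E)"
          using G(2) by blast
        ultimately have "f -` b G \<inter> G \<in> J"
          using CE ideal_on_Un[OF J] ideal_on_subset[OF J] by metis
        with bpos[OF G(1)] show False by blast
      qed
      with C show ?thesis by blast
    next
      case (fin D\<^sub>0)
      \<comment> \<open>By directedness, a smallest \<open>N D\<close> is contained in every other \<open>N E\<close>.\<close>
      then obtain D where D: "D \<in> \<D>" "finite (N D)"
        and least: "\<And>E. E \<in> \<D> \<Longrightarrow> finite (N E) \<Longrightarrow> card (N D) \<le> card (N E)"
        using ex_has_least_nat[of "\<lambda>D. D \<in> \<D> \<and> finite (N D)" D\<^sub>0 "\<lambda>D. card (N D)"] by blast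
      obtain n where n: "n \<in> N D" using fin(3) D(1) by blast
      have "f -` {n} \<inter> E \<notin> J" if E: "E \<in> \<D>" for E
      proof -
        obtain G where G: "G \<in> \<D>" "G \<subseteq> D \<inter> E" using directed[OF D(1) E] by blast
        have "N G \<subseteq> N D" using G(2) by (intro N_mono) blast
        then have "N G = N D"
          using D(2) G(1) least[OF G(1)] by (intro card_seteq) (auto dest: finite_subset)
        moreover have "N G \<subseteq> N E" using G(2) by (intro N_mono) blast
        ultimately show ?thesis using n unfolding N_def by blast
      qed
      moreover have "{n} \<in> I" using ideal_on_finite[OF I] by simp
      ultimately show ?thesis by blast
    qed
  qed
  with bI show ?thesis by (intro exI[of _ b]) blast
qed

section \<open>The cardinal invariants\<close>

lemma fam_card_Card_order: "Card_order (fam_card \<A>)"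
  unfolding fam_card_def by (rule card_of_Card_order)

lemma fam_card_mono: "|\<A>| \<le>o |\<B>| \<Longrightarrow> fam_card \<A> \<le>o fam_card \<B>"
  using fam_card_ordIso ordIso_ordLeq_trans ordLeq_ordIso_trans ordIso_symmetric by blast

lemma cont_succ_Card_order: "Card_order cont_succ"
  unfolding cont_succ_def by (intro cardSuc_Card_order card_of_Card_order)

lemma fam_card_le_cont_succ: "fam_card \<A> \<le>o cont_succ"
proof -
  have "fam_card \<A> \<le>o |UNIV :: nat set set|"
    using fam_card_ordIso card_of_mono1[OF subset_UNIV] ordIso_ordLeq_trans by blast
  also have "|UNIV :: nat set set| \<le>o cont_succ"
    unfolding cont_succ_def by (intro cardSuc_ordLeq card_of_Card_order)
  finally show ?thesis .
qed

lemma p_num_le_cont_succ: "p_num J \<le>o cont_succ"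
  unfolding p_num_def
  by (rule card_min(2)) (auto intro: fam_card_Card_order cont_succ_Card_order)

lemma p_num_le:
  assumes "has_FIP J \<A>" and "\<nexists>B. pseudointersection J \<A> B"
  shows "p_num J \<le>o fam_card \<A>"
  unfolding p_num_def
  by (rule card_min(2)) (use assms in \<open>auto intro: fam_card_Card_order cont_succ_Card_order\<close>)

lemma add_star_le:
  assumes "\<A> \<subseteq> I" and "\<not> (\<exists>B\<in>I. \<forall>A\<in>\<A>. finite (A - B))"
  shows "add_star I \<le>o fam_card \<A>"
  unfolding add_star_def
  by (rule card_min(2)) (use assms in \<open>auto intro: fam_card_Card_order\<close>)

lemma add_star_le_cont_succ:
  assumes "ideal_on UNIV I" and "tall I"
  shows "add_star I \<le>o cont_succ"
  using add_star_le[OF order_refl add_star_witness[OF assms]] fam_card_le_cont_succ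
    ordLeq_transitive by blast

lemma le_fip_num:
  assumes "r \<le>o cont_succ"
    and "\<And>\<A> f. has_FIP J \<A> \<Longrightarrow> f \<in> F \<Longrightarrow> \<not> (\<exists>B\<in>I. has_FIP J (\<A> \<union> {f -` B})) \<Longrightarrow>
      r \<le>o fam_card \<A>"
  shows "r \<le>o fip_num I J F"
proof -
  let ?R = "{fam_card \<A> | \<A>. has_FIP J \<A> \<and>
         \<not> (\<forall>f\<in>F. \<exists>B\<in>I. has_FIP J (\<A> \<union> {f -` B}))} \<union> {cont_succ}"
  have "fip_num I J F \<in> ?R"
    unfolding fip_num_def
    by (rule card_min(1)) (auto intro: fam_card_Card_order cont_succ_Card_order)
  then show ?thesis using assms by auto
qed

text \<open>
  If the sets chosen by \<open>directed_family_common_preimage\<close> were bounded in \<open>I\<close> modulo finite sets,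
  the family could be extended; so they witness \<open>add_star I\<close>.
\<close>

lemma add_star_le_non_extendable:
  fixes f :: "nat \<Rightarrow> nat"
  assumes I: "ideal_on UNIV I" and J: "ideal_on UNIV J" and "tall I"
    and preim: "\<And>D. D \<notin> J \<Longrightarrow> \<exists>B\<in>I. f -` B \<inter> D \<notin> J"
    and FIP: "has_FIP J \<A>" and non_ext: "\<not> (\<exists>B\<in>I. has_FIP J (\<A> \<union> {f -` B}))"
  shows "add_star I \<le>o fam_card \<A>"
proof -
  let ?\<D> = "Inter ` Fpow \<A>"
  have pos: "D \<notin> J" if "D \<in> ?\<D>" for D
    using that FIP unfolding has_FIP_iff_Fpow by blast
  have no_common: "\<not> (\<exists>B\<in>I. \<forall>D\<in>?\<D>. f -` B \<inter> D \<notin> J)"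
  proof
    assume "\<exists>B\<in>I. \<forall>D\<in>?\<D>. f -` B \<inter> D \<notin> J"
    then obtain B where B: "B \<in> I" "\<And>\<B>. \<B> \<in> Fpow \<A> \<Longrightarrow> f -` B \<inter> \<Inter>\<B> \<notin> J" by blast
    have "has_FIP J (\<A> \<union> {f -` B})" by (rule has_FIP_Un_singleton[OF J B(2)])
    with B(1) non_ext show False by blast
  qed
  have "infinite \<A>"
  proof
    assume "finite \<A>"
    then have "\<A> \<in> Fpow \<A>" by (simp add: Fpow_def)
    then have "\<Inter>\<A> \<in> ?\<D>" by (rule imageI)
    from preim[OF pos[OF this]] obtain B where B: "B \<in> I" "f -` B \<inter> \<Inter>\<A> \<notin> J" by blast
    have "f -` B \<inter> \<Inter>\<A> \<subseteq> f -` B \<inter> D" if "D \<in> ?\<D>" for D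
      using that by (auto simp: Fpow_def)
    then have "\<forall>D\<in>?\<D>. f -` B \<inter> D \<notin> J" using B(2) ideal_on_subset[OF J] by metis
    with B(1) no_common show False by blast
  qed
  have directed: "\<exists>G\<in>?\<D>. G \<subseteq> D \<inter> E" if DE: "D \<in> ?\<D>" "E \<in> ?\<D>" for D E
  proof -
    obtain \<B> \<C> where BC: "\<B> \<in> Fpow \<A>" "\<C> \<in> Fpow \<A>" "D = \<Inter>\<B>" "E = \<Inter>\<C>"
      using DE by blast
    then have "\<B> \<union> \<C> \<in> Fpow \<A>" by (auto simp: Fpow_def)
    moreover have "\<Inter>(\<B> \<union> \<C>) \<subseteq> D \<inter> E" using BC by blast
    ultimately show ?thesis by blast
  qed
  have "\<exists>b. b ` ?\<D> \<subseteq> I \<and> (\<forall>C\<in>I. (\<forall>D\<in>?\<D>. finite (b D - C)) \<longrightarrow>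
      (\<exists>B\<in>I. \<forall>D\<in>?\<D>. f -` B \<inter> D \<notin> J))"
    by (rule directed_family_common_preimage[OF I J \<open>tall I\<close> directed preim[OF pos]])
  then obtain b where b: "b ` ?\<D> \<subseteq> I"
    and bounded: "\<forall>C\<in>I. (\<forall>D\<in>?\<D>. finite (b D - C)) \<longrightarrow> (\<exists>B\<in>I. \<forall>D\<in>?\<D>. f -` B \<inter> D \<notin> J)"
    by (elim exE conjE)
  have "add_star I \<le>o fam_card (b ` ?\<D>)"
  proof (rule add_star_le[OF b], rule notI)
    assume "\<exists>C\<in>I. \<forall>B\<in>b ` ?\<D>. finite (B - C)"
    then obtain C where C: "C \<in> I" "\<forall>B\<in>b ` ?\<D>. finite (B - C)" by (elim bexE)
    from C(2) have "\<forall>D\<in>?\<D>. finite (b D - C)" by (intro ballI) (elim bspec, rule imageI)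
    with bspec[OF bounded C(1)] no_common show False by (elim impE notE)
  qed
  moreover have "|b ` ?\<D>| \<le>o |\<A>|"
    unfolding image_comp
    by (rule ordLeq_transitive[OF card_of_image card_of_Fpow_ordLeq_infinite[OF \<open>infinite \<A>\<close>]])
  ultimately show ?thesis by (metis fam_card_mono ordLeq_transitive)
qed

theorem theorem4p1:
  fixes F :: "(nat \<Rightarrow> nat) set" and I J :: "nat set set"
  assumes "ideal_on UNIV I" and "ideal_on UNIV J"
    and "tall I"
    and "\<And>A. A \<notin> J \<Longrightarrow> \<not> le_restr F I J A"
  shows "p_num J \<le>o fip_num I J F \<and> add_star I \<le>o fip_num I J F"
proof
  have preim: "\<exists>B\<in>I. f -` B \<inter> D \<notin> J" if "f \<in> F" "D \<notin> J" for f D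
    using assms(4)[OF that(2)] that(1) unfolding le_restr_def by blast
  show "p_num J \<le>o fip_num I J F"
  proof (rule le_fip_num[OF p_num_le_cont_succ])
    fix \<A> f
    assume A: "has_FIP J \<A>" "f \<in> F" "\<not> (\<exists>B\<in>I. has_FIP J (\<A> \<union> {f -` B}))"
    have "\<not> pseudointersection J \<A> P" for P
    proof
      assume P: "pseudointersection J \<A> P"
      then have "P \<notin> J" unfolding pseudointersection_def by blast
      then obtain B where "B \<in> I" "f -` B \<inter> P \<notin> J" using preim A(2) by blast
      then show False using A(3) FIP_extension_by_pseudointersection[OF assms(2) P] by blast
    qed
    then show "p_num J \<le>o fam_card \<A>" using p_num_le[OF A(1)] by blast
  qed
  show "add_star I \<le>o fip_num I J F"
  proof (rule le_fip_num[OF add_star_le_cont_succ[OF assms(1,3)]])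
    fix \<A> f
    assume A: "has_FIP J \<A>" "f \<in> F" "\<not> (\<exists>B\<in>I. has_FIP J (\<A> \<union> {f -` B}))"
    show "add_star I \<le>o fam_card \<A>"
      by (rule add_star_le_non_extendable[OF assms(1-3) preim[OF A(2)] A(1,3)])
  qed
qed

end
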